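(* Let $E \subset \mathbb{R}$ be a compact set that is a peak set for $A_\ast(\mathbb{H})$. Then $E$ is finite.
   Context: $\mathbb{H} = \{z \in \mathbb{C} : \operatorname{Im} z > 0\}$ is the open upper half-plane and $\overline{\mathbb{H}} = \{z\in\mathbb{C} : \operatorname{Im} z \ge 0\}$ is its closure in $\mathbb{C}$. $A_\ast(\mathbb{H})$ is the set of all bounded continuous functions $f : \overline{\mathbb{H}} \to \mathbb{C}$ that are holomorphic on $\mathbb{H}$ and whose boundary values on $\mathbb{R}$ belong to the Zygmund class: there is a constant $C$ (depending on $f$) such that $|f(x+t) + f(x-t) - 2f(x)| \le C t$ for all $x \in \mathbb{R}$ and all $t > 0$. A compact set $E \subset \mathbb{R}$ is a peak set for $A_\ast(\mathbb{H})$ if there exists $f \in A_\ast(\mathbb{H})$ such that $f(z) = 1$ for all $z \in E$ and $|f(z)| < 1$ for all $z \in \overline{\mathbb{H}} \setminus E$. *)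

theory Defs
  imports "HOL-Analysis.Analysis"
begin

definition upper_half_plane :: "complex set" where
  "upper_half_plane = {z. Im z > 0}"

definition closed_upper_half_plane :: "complex set" where
  "closed_upper_half_plane = {z. Im z \<ge> 0}"

definition zygmund :: "(real \<Rightarrow> complex) \<Rightarrow> bool" where
  "zygmund g \<longleftrightarrow> (\<exists>C::real. \<forall>x t. t > 0 \<longrightarrow> norm (g (x + t) + g (x - t) - 2 * g x) \<le> C * t)"

text \<open>
  Functions on the closed half-plane are represented by total functions on the complex plane;
  every condition only concerns their values on the closed half-plane.
\<close>

definition A_star :: "(complex \<Rightarrow> complex) set" where
  "A_star = {f. bounded (f ` closed_upper_half_plane) \<and>
                continuous_on closed_upper_half_plane f \<and>
                f holomorphic_on upper_half_plane \<and>
                zygmund (\<lambda>x. f (complex_of_real x))}"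

definition peak_set_A_star :: "real set \<Rightarrow> bool" where
  "peak_set_A_star E \<longleftrightarrow> compact E \<and>
     (\<exists>f\<in>A_star. (\<forall>z \<in> complex_of_real ` E. f z = 1) \<and>
                 (\<forall>z \<in> closed_upper_half_plane - complex_of_real ` E. norm (f z) < 1))"

end

theory Submission
  imports Defs "HOL-Complex_Analysis.Great_Picard"
begin

text \<open>
  Let \<open>f\<close> peak on \<open>E\<close> and put \<open>g = 1 - f\<close>, a function with positive real part on the half-plane that
  vanishes on \<open>E\<close>.  If \<open>E\<close> is infinite, it has an accumulation point \<open>a\<close>.  Two forces collide there.

  Positivity makes \<open>g\<close> rise from \<open>a\<close> at least linearly: by the Schwarz--Pick inequality the quotient
  \<open>Re (g (a + \<i> y)) / y\<close> increases as \<open>y\<close> decreases to \<open>0\<close> (\<open>Re_vertical_ratio_nonincreasing\<close>), so that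
  it has a positive, possibly infinite, limit \<open>A\<close>.

  The Zygmund condition is invariant under rescaling, that is, under passing from \<open>g\<close> to
  \<open>G z = g (a + l z) / l\<close>.  If \<open>l\<close> is the distance from \<open>a\<close> to another point of \<open>E\<close>, then \<open>G\<close> has zeros at
  \<open>0\<close> and at \<open>1\<close> or \<open>-1\<close>.  Two zeros pin down a Zygmund function: its size and its modulus of continuity
  at the zeros are bounded in terms of the Zygmund constant alone, on the line
  (\<open>zygmund_growth\<close>) and, by a Phragmen--Lindelof argument, on the half-plane
  (\<open>zygmund_half_plane_bound\<close>).  Evaluating at \<open>\<i>\<close> shows that \<open>A\<close> is finite.

  Now let \<open>l\<close> tend to \<open>0\<close> along points of \<open>E\<close>.  By Montel's theorem the rescalings subconverge, and the
  limit has real part \<open>A y\<close> at \<open>\<i> y\<close>.  This is the equality case of Schwarz--Pick, so the limit is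
  \<open>c - \<i> A z\<close> (\<open>affine_if_Re_linear_on_axis\<close>).  Its values above \<open>0\<close> and above \<open>1\<close> or \<open>-1\<close> differ by \<open>A\<close> in
  modulus at every height, whereas the rescalings are uniformly small near their two zeros.  Hence
  \<open>A = 0\<close>, a contradiction (\<open>no_accumulating_zeros\<close>).
\<close>

section \<open>A maximum principle on the half-plane\<close>

lemma norm_one_minus_i_mult_ge:
  assumes "Im z \<ge> 0"
  shows "norm (1 - \<i> * z) \<ge> 1" and "norm (1 - \<i> * z) \<ge> norm z"
proof -
  have "norm (1 - \<i> * z) \<ge> \<bar>Re (1 - \<i> * z)\<bar>" by (rule abs_Re_le_cmod)
  then show "norm (1 - \<i> * z) \<ge> 1" using assms by simp
  have "(norm z)\<^sup>2 \<le> (norm (1 - \<i> * z))\<^sup>2"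
    unfolding cmod_power2 using assms by (simp add: power2_eq_square algebra_simps)
  then show "norm (1 - \<i> * z) \<ge> norm z" by (rule power2_le_imp_le) simp
qed

text \<open>
  The Phragmen--Lindelof principle in its simplest form.  Dividing \<open>h\<close> by \<open>1 - \<i> e z\<close>, whose modulus
  is at least \<open>1\<close> and grows linearly, makes it small on large half-circles, so the ordinary
  maximum principle applies to a half-disc; then \<open>e\<close> tends to \<open>0\<close>.
\<close>

lemma bounded_holomorphic_upper_half_plane_le:
  assumes holo: "h holomorphic_on upper_half_plane"
    and cont: "continuous_on closed_upper_half_plane h"
    and bdd: "\<And>z. Im z \<ge> 0 \<Longrightarrow> norm (h z) \<le> B"
    and bdry: "\<And>x. norm (h (complex_of_real x)) \<le> M"
    and z: "Im z \<ge> 0"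
  shows "norm (h z) \<le> M"
proof (cases "Im z = 0")
  case True
  then show ?thesis using bdry[of "Re z"] by (simp add: complex_is_Real_iff)
next
  case False
  with z have z0: "Im z > 0" by simp
  have damped: "norm (h z) \<le> (M + e) * norm (1 - \<i> * (of_real e * z))" if e: "e > 0" for e :: real
  proof -
    \<comment> \<open>The radius makes the damped function at most \<open>e\<close> on the arc.  The slack \<open>e\<close> in \<open>M + e\<close>
        is what allows \<open>M = 0\<close>.\<close>
    define R where "R = max (B / e\<^sup>2) (norm z + 1)"
    define S where "S = {w. Im w > 0} \<inter> ball 0 R"
    define k where "k = (\<lambda>w. h w / (1 - \<i> * (of_real e * w)))"
    have R0: "R > 0" "norm z < R" unfolding R_def by (auto simp: less_max_iff_disj intro: add_nonneg_pos)
    have ge: "norm (1 - \<i> * (of_real e * w)) \<ge> 1" "norm (1 - \<i> * (of_real e * w)) \<ge> e * norm w"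
      if "Im w \<ge> 0" for w
      using norm_one_minus_i_mult_ge[of "of_real e * w"] that e by (simp_all add: norm_mult)
    have nz: "1 - \<i> * (of_real e * w) \<noteq> 0" if "Im w \<ge> 0" for w
      using ge(1)[OF that] by (metis norm_zero not_one_le_zero)
    have "open S" unfolding S_def by (intro open_Int open_halfspace_Im_gt open_ball)
    then have int: "interior S = S" by (rule interior_open)
    have cl: "closure S \<subseteq> {w. Im w \<ge> 0} \<inter> cball 0 R"
      by (rule closure_minimal) (auto simp: S_def intro!: closed_halfspace_Im_ge)
    have "norm (k z) \<le> M + e"
    proof (rule maximum_modulus_frontier[of k S])
      show "k holomorphic_on interior S"
        unfolding int k_def
        using holo nz by (intro holomorphic_intros) (auto simp: S_def upper_half_plane_def elim: holomorphic_on_subset)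
      show "continuous_on (closure S) k"
        unfolding k_def using cl nz
        by (intro continuous_intros continuous_on_subset[OF cont]) (auto simp: closed_upper_half_plane_def)
      show "bounded S" unfolding S_def by (simp add: bounded_Int)
      show "z \<in> S" using z0 R0 by (simp add: S_def)
      fix w assume "w \<in> frontier S"
      then have w: "w \<in> closure S" "w \<notin> S" using int by (auto simp: frontier_def)
      then have w0: "Im w \<ge> 0" and wc: "Im w = 0 \<or> norm w = R" using cl by (auto simp: S_def)
      show "norm (k w) \<le> M + e"
      proof (cases "Im w = 0")
        case True
        then have "norm (h w) \<le> M" using bdry[of "Re w"] by (simp add: complex_is_Real_iff)
        moreover have "norm (k w) \<le> norm (h w)"
          using ge(1)[OF w0] unfolding k_def by (simp add: norm_divide divide_le_eq mult_le_cancel_left1 zero_less_mult_iff)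
        ultimately show ?thesis using e by simp
      next
        case False
        with wc have "norm w = R" by simp
        have B0: "B \<ge> 0" using bdd[OF w0] norm_ge_zero order_trans by blast
        have "norm (k w) \<le> B / (e * R)"
          unfolding k_def norm_divide
          using bdd[OF w0] ge(2)[OF w0] \<open>norm w = R\<close> e R0 B0 by (intro frac_le) auto
        also have "\<dots> \<le> e"
        proof -
          have "B / e\<^sup>2 \<le> R" by (simp add: R_def)
          then show ?thesis using e R0 by (simp add: field_simps power2_eq_square)
        qed
        also have "\<dots> \<le> M + e" using bdry[of 0] norm_ge_zero[of "h 0"] by (simp del: norm_ge_zero)
        finally show ?thesis .
      qed
    qed
    then show ?thesis using ge(1)[OF z] unfolding k_def norm_divide
      by (subst (asm) pos_divide_le_eq) auto
  qed
  have "((\<lambda>e. (M + e) * norm (1 - \<i> * (of_real e * z))) \<longlongrightarrow> (M + 0) * norm (1 - \<i> * (of_real 0 * z))) (at_right 0)"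
    by (intro tendsto_intros)
  moreover have "\<forall>\<^sub>F e in at_right 0. norm (h z) \<le> (M + e) * norm (1 - \<i> * (of_real e * z))"
    using damped by (auto simp: eventually_at_right_less eventually_at_filter)
  ultimately have "norm (h z) \<le> (M + 0) * norm (1 - \<i> * (of_real 0 * z))"
    by (rule tendsto_lowerbound) (rule trivial_limit_at_right_real)
  then show ?thesis by simp
qed

section \<open>Zygmund functions with two zeros\<close>

text \<open>
  At a point where the modulus is maximal on the interval, use the second difference whose step
  is the distance to the nearer endpoint.  One of its outer points is a zero and the other stays in
  the interval, so twice the maximum is at most the maximum plus \<open>C / 2\<close>.
\<close>

lemma zygmund_bound_unit_interval:
  fixes \<phi> :: "real \<Rightarrow> complex"
  assumes zyg: "\<And>x t. t > 0 \<Longrightarrow> norm (\<phi> (x + t) + \<phi> (x - t) - 2 * \<phi> x) \<le> C * t"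
    and cont: "continuous_on UNIV \<phi>"
    and zero: "\<phi> 0 = 0" "\<phi> 1 = 0"
    and s: "0 \<le> s" "s \<le> 1"
  shows "norm (\<phi> s) \<le> C / 2"
proof -
  have C: "C \<ge> 0" using order_trans[OF norm_ge_zero zyg[of 1 0]] by simp
  have "continuous_on {0..1} (\<lambda>y. norm (\<phi> y))"
    by (intro continuous_on_norm continuous_on_subset[OF cont]) simp
  then obtain x where x: "x \<in> {0..1}" and xmax: "\<And>y. y \<in> {0..1} \<Longrightarrow> norm (\<phi> y) \<le> norm (\<phi> x)"
    using continuous_attains_sup[of "{0..1::real}" "\<lambda>y. norm (\<phi> y)"] by fastforce
  have "norm (\<phi> x) \<le> C / 2"
  proof (cases "x = 0 \<or> x = 1")
    case True
    then show ?thesis using zero C by auto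
  next
    case False
    define t where "t = min x (1 - x)"
    have t: "0 < t" "t \<le> 1/2" using False x by (auto simp: t_def min_def)
    obtain y where y: "y \<in> {0..1}" "\<phi> (x + t) + \<phi> (x - t) = \<phi> y"
    proof (cases "x \<le> 1/2")
      case True
      then have "t = x" by (simp add: t_def)
      then show ?thesis using that[of "x + t"] zero True x by simp
    next
      case False
      then have "t = 1 - x" by (simp add: t_def)
      then show ?thesis using that[of "x - t"] zero False x by simp
    qed
    have "norm (2 * \<phi> x) \<le> norm (\<phi> y) + norm (\<phi> y - 2 * \<phi> x)"
      using norm_triangle_ineq4[of "\<phi> y" "\<phi> y - 2 * \<phi> x"] by simp
    also have "\<dots> \<le> norm (\<phi> x) + C * t"
      using xmax[OF y(1)] zyg[OF t(1), of x] y(2) by simp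
    also have "C * t \<le> C * (1/2)" using C t by (intro mult_left_mono)
    finally show ?thesis by (simp add: norm_mult)
  qed
  with xmax[of s] s show ?thesis by force
qed

text \<open>
  The zero at the origin turns the second difference at \<open>r\<close> with step \<open>r\<close> into a comparison of the
  values at \<open>2 r\<close> and \<open>r\<close>.  Starting from the unit interval, this is iterated by halving towards \<open>0\<close>
  and by doubling towards infinity.  The true growth is \<open>r\<close> times a logarithm; exponents \<open>1/2\<close> near \<open>0\<close>
  and \<open>3/2\<close> near infinity leave enough room to absorb the additive error at each step.  What matters
  later is that the bound depends on \<open>C\<close> only.
\<close>

lemma zygmund_growth_pos:
  fixes \<phi> :: "real \<Rightarrow> complex"
  assumes zyg: "\<And>x t. t > 0 \<Longrightarrow> norm (\<phi> (x + t) + \<phi> (x - t) - 2 * \<phi> x) \<le> C * t"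
    and cont: "continuous_on UNIV \<phi>"
    and zero: "\<phi> 0 = 0" "\<phi> 1 = 0"
    and s: "0 \<le> s"
  shows "norm (\<phi> s) \<le> 2 * C * (sqrt s * (1 + s))"
proof -
  have C: "C \<ge> 0" using order_trans[OF norm_ge_zero zyg[of 1 0]] by simp
  have unit: "norm (\<phi> r) \<le> C / 2" if "0 \<le> r" "r \<le> 1" for r
    using zygmund_bound_unit_interval[OF zyg cont zero that] by simp
  have doubling: "norm (\<phi> (2 * r) - 2 * \<phi> r) \<le> C * r" if "r > 0" for r
    using zyg[OF that, of r] zero by simp
  have sqrt2: "sqrt 2 \<le> 1.4143" by (rule real_le_lsqrt) (auto simp: power2_eq_square)
  have small: "norm (\<phi> r) \<le> 2 * C * sqrt r" if "1 / 2 ^ n \<le> r" "r \<le> 1" for r n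
    using that
  proof (induction n arbitrary: r)
    case 0
    then show ?case using zero C by auto
  next
    case (Suc n)
    have r0: "r > 0" using Suc.prems(1) by (rule less_le_trans[rotated]) simp
    show ?case
    proof (cases "r \<ge> 1/2")
      case True
      have "1/2 \<le> sqrt r" using True by (intro real_le_rsqrt) (auto simp: power2_eq_square)
      then have "C * (1/2) \<le> C * (2 * sqrt r)" using C by (intro mult_left_mono) auto
      with unit[of r] Suc.prems r0 show ?thesis by simp
    next
      case False
      have IH: "norm (\<phi> (2 * r)) \<le> 2 * C * sqrt (2 * r)"
        using Suc.prems False by (intro Suc.IH) (auto simp: field_simps)
      have "norm (2 * \<phi> r) \<le> norm (\<phi> (2 * r)) + norm (\<phi> (2 * r) - 2 * \<phi> r)"
        using norm_triangle_ineq4[of "\<phi> (2 * r)" "\<phi> (2 * r) - 2 * \<phi> r"] by simp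
      also have "\<dots> \<le> 2 * C * sqrt (2 * r) + C * r" using IH doubling[OF r0] by simp
      finally have "2 * norm (\<phi> r) \<le> 2 * C * sqrt 2 * sqrt r + C * r"
        by (simp add: norm_mult real_sqrt_mult)
      moreover have "r \<le> sqrt r" using Suc.prems r0
        by (intro real_le_rsqrt) (auto simp: power2_eq_square mult_le_cancel_left1)
      then have "C * r \<le> C * sqrt r" using C by (rule mult_left_mono)
      moreover have "(C * sqrt r) * sqrt 2 \<le> (C * sqrt r) * 1.4143"
        using C r0 sqrt2 by (intro mult_left_mono) auto
      moreover have "0 \<le> C * sqrt r" using C r0 by simp
      ultimately show ?thesis by (simp add: algebra_simps)
    qed
  qed
  have large: "norm (\<phi> r) \<le> 2 * C * (r * sqrt r)" if "1 \<le> r" "r \<le> 2 ^ n" for r n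
    using that
  proof (induction n arbitrary: r)
    case 0
    then show ?case using zero C by auto
  next
    case (Suc n)
    have r1: "1 \<le> sqrt r" using Suc.prems by simp
    have "r * 1 \<le> r * sqrt r" using r1 Suc.prems by (intro mult_left_mono) auto
    then have rr: "C * r \<le> C * (r * sqrt r)" using C by (intro mult_left_mono) auto
    have "C * 1 \<le> C * r" using C Suc.prems by (intro mult_left_mono) auto
    then have rr': "C \<le> C * r" by simp
    have "norm (\<phi> r) \<le> norm (2 * \<phi> (r/2)) + norm (\<phi> r - 2 * \<phi> (r/2))"
      using norm_triangle_ineq[of "2 * \<phi> (r/2)" "\<phi> r - 2 * \<phi> (r/2)"] by simp
    also have "\<dots> \<le> 2 * norm (\<phi> (r/2)) + C * (r/2)"
      using doubling[of "r/2"] Suc.prems by (simp add: norm_mult)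
    finally have step: "norm (\<phi> r) \<le> 2 * norm (\<phi> (r/2)) + C * (r/2)" .
    show ?case
    proof (cases "r \<le> 2")
      case True
      have "norm (\<phi> (r/2)) \<le> C / 2" using True Suc.prems by (intro unit) auto
      with step rr rr' C show ?thesis by (simp add: mult.assoc)
    next
      case False
      have "norm (\<phi> (r/2)) \<le> 2 * C * (r/2 * sqrt (r/2))"
        using Suc.prems False by (intro Suc.IH) auto
      also have "sqrt (r/2) = sqrt 2 / 2 * sqrt r"
        by (simp add: real_sqrt_divide real_div_sqrt field_simps)
      finally have "2 * norm (\<phi> (r/2)) \<le> sqrt 2 * (C * (r * sqrt r))"
        by (simp add: algebra_simps)
      also have "\<dots> \<le> 1.4143 * (C * (r * sqrt r))"
        using C Suc.prems sqrt2 by (intro mult_right_mono) auto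
      finally have "norm (\<phi> r) \<le> 1.9143 * (C * (r * sqrt r))" using step rr by simp
      also have "\<dots> \<le> 2 * (C * (r * sqrt r))" using C Suc.prems by (intro mult_right_mono) auto
      finally show ?thesis by (simp add: mult.assoc)
    qed
  qed
  show ?thesis
  proof (cases "s \<le> 1")
    case True
    show ?thesis
    proof (cases "s = 0")
      case False
      then obtain n where "(1/2) ^ n < s" using s real_arch_pow_inv[of s "1/2"] by auto
      then have "norm (\<phi> s) \<le> 2 * C * sqrt s" using True by (intro small[of n]) (auto simp: power_divide)
      also have "\<dots> \<le> 2 * C * (sqrt s * (1 + s))"
        using C s by (intro mult_left_mono) (auto simp: algebra_simps)
      finally show ?thesis .
    qed (use zero in simp)
  next
    case False
    obtain n where "s < 2 ^ n" using real_arch_pow[of 2 s] by auto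
    then have "norm (\<phi> s) \<le> 2 * C * (s * sqrt s)" using False by (intro large[of _ n]) auto
    also have "\<dots> \<le> 2 * C * (sqrt s * (1 + s))"
      using C s by (intro mult_left_mono) (auto simp: algebra_simps)
    finally show ?thesis .
  qed
qed

text \<open>
  The two zeros can be interchanged or reflected by an affine change of variable, which preserves
  the Zygmund constant because they are at distance \<open>1\<close>; the second difference at the zero \<open>a\<close>
  carries the estimate from one side of \<open>a\<close> to the other.
\<close>

lemma zygmund_growth:
  fixes \<phi> :: "real \<Rightarrow> complex"
  assumes zyg: "\<And>x t. t > 0 \<Longrightarrow> norm (\<phi> (x + t) + \<phi> (x - t) - 2 * \<phi> x) \<le> C * t"
    and cont: "continuous_on UNIV \<phi>"
    and zero: "\<phi> a = 0" "\<phi> b = 0" "\<bar>b - a\<bar> = 1"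
  shows "norm (\<phi> (a + s)) \<le> 3 * C * (sqrt \<bar>s\<bar> * (1 + \<bar>s\<bar>))"
proof -
  have C: "C \<ge> 0" using order_trans[OF norm_ge_zero zyg[of 1 0]] by simp
  define \<psi> where "\<psi> = (\<lambda>r. \<phi> (a + (b - a) * r))"
  have ab: "b - a = 1 \<or> b - a = -1" using zero(3) by linarith
  have zyg': "norm (\<psi> (x + t) + \<psi> (x - t) - 2 * \<psi> x) \<le> C * t" if "t > 0" for x t
    using zyg[OF that, of "a + (b - a) * x"] ab unfolding \<psi>_def
    by (auto simp: algebra_simps)
  have cont': "continuous_on UNIV \<psi>" unfolding \<psi>_def
    by (intro continuous_intros continuous_on_compose2[OF cont]) auto
  have zero': "\<psi> 0 = 0" "\<psi> 1 = 0" using zero by (auto simp: \<psi>_def)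
  note pos = zygmund_growth_pos[OF zyg' cont' zero', simplified]
  have main: "norm (\<psi> r) \<le> 3 * C * (sqrt \<bar>r\<bar> * (1 + \<bar>r\<bar>))" for r
  proof (cases "r \<ge> 0")
    case True
    have "norm (\<psi> r) \<le> 2 * C * (sqrt \<bar>r\<bar> * (1 + \<bar>r\<bar>))" using pos[of r] True by simp
    also have "\<dots> \<le> 3 * C * (sqrt \<bar>r\<bar> * (1 + \<bar>r\<bar>))" using C by (intro mult_right_mono) auto
    finally show ?thesis .
  next
    case False
    define q where "q = -r"
    have q: "q > 0" using False by (simp add: q_def)
    have "norm (\<psi> (-q)) \<le> norm (\<psi> q) + norm (\<psi> q + \<psi> (-q))"
      using norm_triangle_ineq4[of "\<psi> q + \<psi> (-q)" "\<psi> q"] by simp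
    also have "norm (\<psi> q + \<psi> (-q)) \<le> C * q" using zyg'[OF q, of 0] zero' by simp
    also have "norm (\<psi> q) \<le> 2 * C * (sqrt q * (1 + q))" using pos[of q] q by simp
    also have "C * q \<le> C * (sqrt q * (1 + q))"
    proof (rule mult_left_mono[OF _ C])
      have "sqrt q \<le> 1 + q" using q by (intro real_le_lsqrt) (auto simp: power2_eq_square algebra_simps)
      then have "sqrt q * sqrt q \<le> sqrt q * (1 + q)" using q by (intro mult_left_mono) auto
      then show "q \<le> sqrt q * (1 + q)" using q by simp
    qed
    finally have "norm (\<psi> (-q)) \<le> 3 * C * (sqrt q * (1 + q))" by (simp add: mult.assoc)
    then show ?thesis using False by (simp add: q_def)
  qed
  have "\<phi> (a + s) = \<psi> ((b - a) * s)" using ab by (auto simp: \<psi>_def)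
  moreover have "\<bar>(b - a) * s\<bar> = \<bar>s\<bar>" using zero(3) by (simp add: abs_mult)
  ultimately show ?thesis using main[of "(b - a) * s"] by simp
qed

text \<open>
  The estimate on the line extends to the half-plane by comparing \<open>G\<close> with the explicit holomorphic
  function \<open>csqrt (\<delta> - \<i> z) * (1 - \<i> z)\<close>, whose modulus on the line dominates the real bound up to a
  constant.  The shift \<open>\<delta>\<close> keeps this function away from zero, so that the quotient is bounded.  With
  \<open>\<delta> = 1\<close> the estimate is a local bound, and with \<open>\<delta>\<close> comparable to \<open>norm z\<close> it is a modulus of continuity
  at the zero \<open>a\<close>; both are uniform in \<open>G\<close>.
\<close>

lemma zygmund_half_plane_bound:
  assumes holo: "G holomorphic_on upper_half_plane"
    and cont: "continuous_on closed_upper_half_plane G"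
    and bdd: "\<And>z. Im z \<ge> 0 \<Longrightarrow> norm (G z) \<le> B"
    and zyg: "\<And>x t. t > 0 \<Longrightarrow> norm (G (complex_of_real (x + t)) + G (complex_of_real (x - t))
                - 2 * G (complex_of_real x)) \<le> C * t"
    and zero: "G (complex_of_real a) = 0" "G (complex_of_real b) = 0" "\<bar>b - a\<bar> = 1"
    and \<delta>: "\<delta> > 0" and z: "Im z \<ge> 0"
  shows "norm (G (complex_of_real a + z))
           \<le> 5 * C * (sqrt (norm (complex_of_real \<delta> - \<i> * z)) * norm (1 - \<i> * z))"
proof -
  have C: "C \<ge> 0" using order_trans[OF norm_ge_zero zyg[of 1 0]] by simp
  define m where "m = (\<lambda>w. csqrt (of_real \<delta> - \<i> * w) * (1 - \<i> * w))"
  define h where "h = (\<lambda>w. G (of_real a + w) / m w)"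
  have root_ge: "sqrt \<delta> \<le> sqrt (norm (of_real \<delta> - \<i> * w))" if "Im w \<ge> 0" for w
    using complex_Re_le_cmod[of "of_real \<delta> - \<i> * w"] that by simp
  have norm_m: "norm (m w) = sqrt (norm (of_real \<delta> - \<i> * w)) * norm (1 - \<i> * w)" for w
    by (simp add: m_def norm_mult)
  have m_ge: "sqrt \<delta> \<le> norm (m w)" if "Im w \<ge> 0" for w
    using mult_mono[OF root_ge[OF that] norm_one_minus_i_mult_ge(1)[OF that]] by (simp add: norm_m)
  have m_nz: "m w \<noteq> 0" if "Im w \<ge> 0" for w
    using m_ge[OF that] \<delta> by (metis norm_zero not_le real_sqrt_gt_zero)
  have slit: "of_real \<delta> - \<i> * w \<notin> \<real>\<^sub>\<le>\<^sub>0" if "Im w \<ge> 0" for w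
    using that \<delta> by (auto simp: complex_nonpos_Reals_iff)
  have "norm (h z) \<le> 5 * C"
  proof (rule bounded_holomorphic_upper_half_plane_le[OF _ _ _ _ z])
    have "(\<lambda>w. G (of_real a + w)) holomorphic_on upper_half_plane"
      by (rule holomorphic_on_compose_gen[of "\<lambda>w. of_real a + w" _ G, unfolded o_def, OF _ holo])
        (auto simp: upper_half_plane_def intro!: holomorphic_intros)
    then show "h holomorphic_on upper_half_plane"
      unfolding h_def using m_nz slit
      by (intro holomorphic_intros) (auto simp: m_def upper_half_plane_def intro!: holomorphic_intros)
    have "continuous_on closed_upper_half_plane (\<lambda>w. G (of_real a + w))"
      by (rule continuous_on_compose2[OF cont])
        (auto simp: closed_upper_half_plane_def intro!: continuous_intros)
    moreover have "m holomorphic_on closed_upper_half_plane"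
      unfolding m_def using slit by (intro holomorphic_intros) (auto simp: closed_upper_half_plane_def)
    ultimately show "continuous_on closed_upper_half_plane h"
      unfolding h_def using m_nz
      by (intro continuous_on_divide holomorphic_on_imp_continuous_on[of m]) (auto simp: closed_upper_half_plane_def)
    show "norm (h w) \<le> B / sqrt \<delta>" if "Im w \<ge> 0" for w
    proof -
      have "norm (G (of_real a + w)) \<le> B" using that by (intro bdd) simp
      then show ?thesis unfolding h_def norm_divide
        using m_ge[OF that] \<delta> by (intro frac_le) (auto intro: order_trans[OF norm_ge_zero])
    qed
    show "norm (h (of_real s)) \<le> 5 * C" for s
    proof -
      have contR: "continuous_on UNIV (\<lambda>x. G (of_real x))"
        by (rule continuous_on_compose2[OF cont])
          (auto simp: closed_upper_half_plane_def intro!: continuous_intros)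
      have "norm (G (of_real (a + s))) \<le> 3 * C * (sqrt \<bar>s\<bar> * (1 + \<bar>s\<bar>))"
        by (rule zygmund_growth[OF zyg contR zero])
      also have "\<dots> = C * (sqrt \<bar>s\<bar> * (3 * (1 + \<bar>s\<bar>)))" by simp
      also have "\<dots> \<le> C * (sqrt (norm (of_real \<delta> - \<i> * of_real s)) * (5 * norm (1 - \<i> * of_real s)))"
      proof (rule mult_left_mono[OF mult_mono C])
        show "sqrt \<bar>s\<bar> \<le> sqrt (norm (of_real \<delta> - \<i> * of_real s))"
          using abs_Im_le_cmod[of "of_real \<delta> - \<i> * of_real s"] by simp
        have "(3 * (1 + \<bar>s\<bar>))\<^sup>2 \<le> (5 * norm (1 - \<i> * of_real s))\<^sup>2"
          unfolding power_mult_distrib cmod_power2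
          using zero_le_power2[of "1 - \<bar>s\<bar>"] zero_le_power2[of s] 
          by (simp add: power2_sum power2_diff del: zero_le_power2)
        then show "3 * (1 + \<bar>s\<bar>) \<le> 5 * norm (1 - \<i> * of_real s)"
          by (rule power2_le_imp_le) simp
      qed auto
      also have "\<dots> = 5 * C * norm (m (of_real s))" by (simp add: norm_m)
      finally have "norm (G (of_real a + of_real s)) \<le> 5 * C * norm (m (of_real s))" by simp
      then show ?thesis using m_nz[of "of_real s"] by (simp add: h_def norm_divide pos_divide_le_eq)
    qed
  qed
  then show ?thesis using m_nz[OF z] unfolding norm_m[symmetric]
    by (simp add: h_def norm_divide pos_divide_le_eq)
qed

section \<open>Holomorphic maps from the upper to the right half-plane\<close>

lemma norm_diff_less_norm_add_cnj:
  assumes "Re a > 0" "Re b > 0"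
  shows "norm (a - b) < norm (a + cnj b)"
proof -
  have "(norm (a - b))\<^sup>2 < (norm (a + cnj b))\<^sup>2"
    unfolding cmod_power2 using mult_pos_pos[OF assms] by (simp add: power2_eq_square algebra_simps)
  then show ?thesis by (rule power2_less_imp_less) simp
qed

text \<open>
  The Schwarz lemma after Cayley transforms in domain and range: \<open>\<psi>\<close> maps the disc to the upper
  half-plane with \<open>\<psi> 0 = z\<close>, and \<open>u \<mapsto> (u - g z) / (u + cnj (g z))\<close> maps the right half-plane to the
  disc and \<open>g z\<close> to \<open>0\<close>.
\<close>

lemma Schwarz_Pick_half_planes_strict:
  assumes holo: "g holomorphic_on upper_half_plane"
    and pos: "\<And>w. Im w > 0 \<Longrightarrow> Re (g w) > 0"
    and z: "Im z > 0"
  shows "norm (deriv g z) * Im z \<le> Re (g z)"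
proof -
  define \<psi> where "\<psi> = (\<lambda>w. of_real (Re z) + \<i> * of_real (Im z) * ((1 + w) / (1 - w)))"
  define \<phi> where "\<phi> = (\<lambda>w. (g (\<psi> w) - g z) / (g (\<psi> w) + cnj (g z)))"
  have \<psi>0: "\<psi> 0 = z" by (simp add: \<psi>_def complex_eq_iff)
  have Im_\<psi>: "Im (\<psi> w) > 0" if "norm w < 1" for w
  proof -
    have nz: "1 - w \<noteq> 0" using that by auto
    have "Re w * Re w + Im w * Im w < 1"
      using that abs_square_less_1[of "norm w"] cmod_power2[of w] by (simp add: power2_eq_square)
    then have "Re ((1 + w) * cnj (1 - w)) > 0" by (simp add: algebra_simps)
    then have "Re ((1 + w) / (1 - w)) > 0"
      unfolding complex_div_cnj[of "1 + w"] of_real_power[symmetric] Re_divide_of_real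
      using nz by (intro divide_pos_pos) auto
    moreover have "Im (\<psi> w) = Im z * Re ((1 + w) / (1 - w))" 
      unfolding \<psi>_def by (simp del: times_divide_eq_right)
    ultimately show ?thesis using z by (simp only: mult_pos_pos)
  qed
  have \<psi>_holo: "\<psi> holomorphic_on ball 0 1"
    unfolding \<psi>_def by (intro holomorphic_intros) auto
  have g\<psi>: "(\<lambda>w. g (\<psi> w)) holomorphic_on ball 0 1"
    by (rule holomorphic_on_compose_gen[unfolded o_def, OF \<psi>_holo holo])
      (use Im_\<psi> in \<open>auto simp: upper_half_plane_def\<close>)
  have less: "norm (g (\<psi> w) - g z) < norm (g (\<psi> w) + cnj (g z))" if "norm w < 1" for w
    using Im_\<psi>[OF that] z by (intro norm_diff_less_norm_add_cnj pos)
  then have nz: "g (\<psi> w) + cnj (g z) \<noteq> 0" if "norm w < 1" for w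
    using that by (metis norm_ge_zero norm_zero not_le)
  have "norm (deriv \<phi> 0) \<le> 1"
  proof (rule Schwarz_Lemma(2))
    show "\<phi> holomorphic_on ball 0 1"
      unfolding \<phi>_def using nz by (intro holomorphic_intros g\<psi>) auto
    show "\<phi> 0 = 0" by (simp add: \<phi>_def \<psi>0)
    show "norm (\<phi> w) < 1" if "norm w < 1" for w
      using less[OF that] nz[OF that] by (simp add: \<phi>_def norm_divide divide_less_eq)
    show "norm (0::complex) < 1" by simp
  qed
  moreover have "deriv \<phi> 0 = deriv g z * (2 * \<i> * of_real (Im z)) / (g z + cnj (g z))"
  proof (rule DERIV_imp_deriv)
    have d\<psi>: "(\<psi> has_field_derivative (2 * \<i> * of_real (Im z))) (at 0)"
      unfolding \<psi>_def by (auto intro!: derivative_eq_intros)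
    have dg: "(g has_field_derivative deriv g z) (at (\<psi> 0))"
      unfolding \<psi>0 using holo z
      by (intro holomorphic_derivI[of g upper_half_plane]) (auto simp: upper_half_plane_def open_halfspace_Im_gt)
    note d = DERIV_chain2[OF dg d\<psi>]
    have nz0: "g z + cnj (g z) \<noteq> 0" using nz[of 0] by (simp add: \<psi>0)
    show "(\<phi> has_field_derivative deriv g z * (2 * \<i> * of_real (Im z)) / (g z + cnj (g z))) (at 0)"
      unfolding \<phi>_def
      by (rule derivative_eq_intros refl d | use nz0 in \<open>simp add: \<psi>0\<close>)+
  qed
  moreover have "g z + cnj (g z) = of_real (2 * Re (g z))" by (simp add: complex_eq_iff)
  ultimately have "norm (deriv g z) * (2 * Im z) / (2 * Re (g z)) \<le> 1"
    using z pos[OF z] by (simp add: norm_mult norm_divide)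
  then show ?thesis using pos[OF z] by (simp add: divide_le_eq)
qed

lemma Schwarz_Pick_half_planes:
  assumes holo: "g holomorphic_on upper_half_plane"
    and pos: "\<And>w. Im w > 0 \<Longrightarrow> Re (g w) \<ge> 0"
    and z: "Im z > 0"
  shows "norm (deriv g z) * Im z \<le> Re (g z)"
proof (rule field_le_epsilon)
  fix e :: real assume e: "e > 0"
  have "g field_differentiable at z"
    using holo z by (intro holomorphic_on_imp_differentiable_at[of g upper_half_plane])
      (auto simp: upper_half_plane_def open_halfspace_Im_gt)
  then have "deriv (\<lambda>w. g w + of_real e) z = deriv g z" by simp
  moreover have "norm (deriv (\<lambda>w. g w + of_real e) z) * Im z \<le> Re (g z + of_real e)"
    using pos e z by (intro Schwarz_Pick_half_planes_strict holomorphic_intros holo) (auto intro: add_nonneg_pos)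
  ultimately show "norm (deriv g z) * Im z \<le> Re (g z) + e" by simp
qed

lemma has_derivative_Re_vertical:
  assumes holo: "g holomorphic_on upper_half_plane" and y: "y > 0"
  shows "((\<lambda>y. Re (g (Complex a y))) has_real_derivative Re (\<i> * deriv g (Complex a y))) (at y)"
proof -
  have eq: "Complex a t = of_real a + \<i> * of_real t" for t by (simp add: complex_eq_iff)
  have dg: "(g has_field_derivative deriv g (Complex a y)) (at (Complex a y))"
    using holo y by (intro holomorphic_derivI[of g upper_half_plane])
      (auto simp: upper_half_plane_def open_halfspace_Im_gt)
  have dv: "((\<lambda>t. Complex a t) has_vector_derivative \<i>) (at y)"
    unfolding eq by (auto intro!: derivative_eq_intros has_vector_derivative_real_field)
  have "((g \<circ> Complex a) has_vector_derivative \<i> * deriv g (Complex a y)) (at y)"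
    by (rule field_vector_diff_chain_at[OF dv dg])
  from bounded_linear.has_vector_derivative[OF bounded_linear_Re this]
  show ?thesis by (simp add: o_def has_real_derivative_iff_has_vector_derivative)
qed

text \<open>
  The part of the Julia--Wolff theorem that is needed: with \<open>u = Re g\<close>, Schwarz--Pick says that the
  vertical derivative of \<open>u\<close> is at most \<open>u / y\<close>, which is exactly the condition for \<open>u / y\<close> to have
  nonpositive derivative.  So \<open>u / y\<close> has a limit in \<open>(0, \<infinity>]\<close> at the boundary.
\<close>

lemma Re_vertical_ratio_nonincreasing:
  assumes holo: "g holomorphic_on upper_half_plane"
    and pos: "\<And>w. Im w > 0 \<Longrightarrow> Re (g w) \<ge> 0"
    and y: "0 < y1" "y1 \<le> y2"
  shows "Re (g (Complex a y2)) / y2 \<le> Re (g (Complex a y1)) / y1"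
proof (rule DERIV_nonpos_imp_nonincreasing[OF y(2)])
  fix y assume "y1 \<le> y" "y \<le> y2"
  with y have y0: "y > 0" by simp
  have "Re (\<i> * deriv g (Complex a y)) * y \<le> norm (\<i> * deriv g (Complex a y)) * y"
    using y0 by (intro mult_right_mono complex_Re_le_cmod) simp
  also have "\<dots> \<le> Re (g (Complex a y))"
    using Schwarz_Pick_half_planes[OF holo pos, of "Complex a y"] y0 by (simp add: norm_mult)
  finally have le: "Re (\<i> * deriv g (Complex a y)) * y - Re (g (Complex a y)) \<le> 0" by simp
  show "\<exists>d. ((\<lambda>y. Re (g (Complex a y)) / y) has_real_derivative d) (at y) \<and> d \<le> 0"
  proof (intro exI conjI)
    show "((\<lambda>y. Re (g (Complex a y)) / y) has_real_derivative
      (Re (\<i> * deriv g (Complex a y)) * y - Re (g (Complex a y)) * 1) / (y * y)) (at y)"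
      using y0 by (intro DERIV_divide has_derivative_Re_vertical[OF holo]) auto
    show "(Re (\<i> * deriv g (Complex a y)) * y - Re (g (Complex a y)) * 1) / (y * y) \<le> 0"
      using le y0 by (intro divide_nonpos_pos) auto
  qed
qed

text \<open>
  The equality case: on the axis the vertical derivative \<open>A\<close> of \<open>Re G\<close> is the real part of
  \<open>\<i> * deriv G\<close>, while Schwarz--Pick bounds the modulus of that number by \<open>A\<close>.  Hence \<open>deriv G\<close> is
  constant on the axis, and by the identity theorem everywhere.
\<close>

lemma affine_if_Re_linear_on_axis:
  assumes holo: "G holomorphic_on upper_half_plane"
    and pos: "\<And>w. Im w > 0 \<Longrightarrow> Re (G w) \<ge> 0"
    and axis: "\<And>y. y > 0 \<Longrightarrow> Re (G (Complex 0 y)) = A * y"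
  obtains c where "\<And>z. Im z > 0 \<Longrightarrow> G z = c - \<i> * of_real A * z"
proof -
  have op: "open upper_half_plane" and conv: "convex upper_half_plane"
    by (simp_all add: upper_half_plane_def open_halfspace_Im_gt convex_halfspace_Im_gt)
  have on_axis: "deriv G (Complex 0 y) = - \<i> * of_real A" if y: "y > 0" for y
  proof -
    have "((\<lambda>y. A * y) has_real_derivative A) (at y)" by (auto intro!: derivative_eq_intros)
    then have "((\<lambda>y. Re (G (Complex 0 y))) has_real_derivative A) (at y)"
      by (rule has_field_derivative_transform_within_open[of _ _ _ "{0<..}"]) (use y axis in auto)
    then have re: "Re (\<i> * deriv G (Complex 0 y)) = A"
      using has_derivative_Re_vertical[OF holo y] DERIV_unique by blast
    have "norm (\<i> * deriv G (Complex 0 y)) * y \<le> A * y"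
      using Schwarz_Pick_half_planes[OF holo pos, of "Complex 0 y"] y axis[OF y] by (simp add: norm_mult)
    then have "norm (\<i> * deriv G (Complex 0 y)) \<le> A" using y by simp
    then have "(norm (\<i> * deriv G (Complex 0 y)))\<^sup>2 \<le> A\<^sup>2" by (intro power_mono) auto
    then have "(Im (\<i> * deriv G (Complex 0 y)))\<^sup>2 \<le> 0"
      unfolding cmod_power2 re by simp
    then have "Im (\<i> * deriv G (Complex 0 y)) = 0" by simp
    with re show ?thesis by (simp add: complex_eq_iff)
  qed
  have deriv_eq: "deriv G z + \<i> * of_real A = 0" if "z \<in> upper_half_plane" for z
  proof (rule analytic_continuation[of "\<lambda>z. deriv G z + \<i> * of_real A" upper_half_plane
        "Complex 0 ` {0<..}" \<i>])
    show "(\<lambda>z. deriv G z + \<i> * of_real A) holomorphic_on upper_half_plane"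
      by (intro holomorphic_intros holomorphic_deriv holo op)
    show "connected upper_half_plane" using conv by (rule convex_connected)
    show "\<i> islimpt Complex 0 ` {0<..}"
      unfolding islimpt_sequential
    proof (intro exI conjI allI)
      show "Complex 0 (1 + 1 / real (Suc n)) \<in> Complex 0 ` {0<..} - {\<i>}" for n
        by (auto simp: complex_eq_iff intro!: imageI add_pos_pos)
      have "(\<lambda>n. 1 + 1 / real (Suc n)) \<longlonglongrightarrow> 1 + 0"
        by (intro tendsto_intros lim_inverse_n'[THEN LIMSEQ_Suc])
      then have "(\<lambda>n. Complex 0 (1 + 1 / real (Suc n))) \<longlonglongrightarrow> Complex 0 (1 + 0)"
        by (intro tendsto_Complex tendsto_const)
      then show "(\<lambda>n. Complex 0 (1 + 1 / real (Suc n))) \<longlonglongrightarrow> \<i>"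
        by (simp add: complex_eq_iff Complex_eq)
    qed
  qed (use that op on_axis in \<open>auto simp: upper_half_plane_def\<close>)
  have "\<exists>c. \<forall>z\<in>upper_half_plane. G z + \<i> * of_real A * z = c"
  proof (rule has_field_derivative_zero_constant[OF conv])
    fix z assume z: "z \<in> upper_half_plane"
    have "((\<lambda>z. G z + \<i> * of_real A * z) has_field_derivative (deriv G z + \<i> * of_real A * 1)) (at z)"
      by (intro DERIV_add holomorphic_derivI[OF holo op z] DERIV_cmult DERIV_ident)
    with deriv_eq[OF z] show "((\<lambda>z. G z + \<i> * of_real A * z) has_field_derivative 0) (at z within upper_half_plane)"
      by (simp add: has_field_derivative_at_within)
  qed
  then obtain c where "\<And>z. z \<in> upper_half_plane \<Longrightarrow> G z + \<i> * of_real A * z = c" by blast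
  then show thesis by (intro that[of c]) (auto simp: upper_half_plane_def eq_diff_eq)
qed

section \<open>Blowing up at an accumulation point of zeros\<close>

text \<open>
  The rescalings \<open>F n\<close> about \<open>a\<close> by the distance to \<open>x n\<close> keep the Zygmund constant of \<open>g\<close> and vanish at \<open>0\<close>
  and at a point \<open>\<sigma> n = \<plusminus>1\<close>.  They are therefore locally bounded uniformly in \<open>n\<close>, which forces the
  vertical derivative \<open>A\<close> of \<open>Re g\<close> at \<open>a\<close> to be finite, and they subconverge to a map which takes equality
  in Schwarz--Pick on the axis, hence is affine with slope \<open>- \<i> A\<close>.  The uniform modulus of continuity
  at both zeros prevents the values of \<open>F n\<close> above \<open>0\<close> and above \<open>\<sigma> n\<close> from differing by \<open>A\<close>.
\<close>

lemma no_accumulating_zeros: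
  assumes holo: "g holomorphic_on upper_half_plane"
    and cont: "continuous_on closed_upper_half_plane g"
    and bdd: "\<And>z. Im z \<ge> 0 \<Longrightarrow> norm (g z) \<le> B"
    and zyg: "\<And>x t. t > 0 \<Longrightarrow> norm (g (complex_of_real (x + t)) + g (complex_of_real (x - t))
                - 2 * g (complex_of_real x)) \<le> C * t"
    and pos: "\<And>w. Im w > 0 \<Longrightarrow> Re (g w) > 0"
    and zeros: "g (complex_of_real a) = 0" "\<And>n. g (complex_of_real (x n)) = 0"
    and x: "\<And>n. x n \<noteq> a" "x \<longlonglongrightarrow> a"
  shows False
proof -
  define l where "l = (\<lambda>n. \<bar>x n - a\<bar>)"
  define \<sigma> where "\<sigma> = (\<lambda>n. (x n - a) / l n)"
  define F where "F = (\<lambda>n z. g (of_real a + of_real (l n) * z) / of_real (l n))"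
  have l0: "l n > 0" for n using x(1)[of n] by (simp add: l_def)
  have l_lim: "l \<longlonglongrightarrow> 0"
    unfolding l_def using x(2) by (simp add: tendsto_rabs_zero LIM_zero)
  have \<sigma>: "\<sigma> n = 1 \<or> \<sigma> n = -1" for n using x(1)[of n] by (auto simp: \<sigma>_def l_def abs_if divide_simps)
  have F_holo: "F n holomorphic_on upper_half_plane" for n
  proof -
    have "(\<lambda>z. g (of_real a + of_real (l n) * z)) holomorphic_on upper_half_plane"
      by (rule holomorphic_on_compose_gen[of "\<lambda>z. of_real a + of_real (l n) * z" _ g, unfolded o_def, OF _ holo])
        (use l0[of n] in \<open>auto simp: upper_half_plane_def intro!: holomorphic_intros\<close>)
    then show ?thesis unfolding F_def using l0[of n] by (intro holomorphic_intros) auto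
  qed
  have F_bound: "norm (F n (of_real s + z)) \<le> 5 * C * (sqrt (norm (complex_of_real \<delta> - \<i> * z)) * norm (1 - \<i> * z))"
    if "s = 0 \<or> s = \<sigma> n" "\<delta> > 0" "Im z \<ge> 0" for n s z \<delta>
  proof (rule zygmund_half_plane_bound[OF F_holo])
    have "continuous_on closed_upper_half_plane (\<lambda>z. g (of_real a + of_real (l n) * z))"
      by (rule continuous_on_compose2[OF cont])
        (use l0[of n] in \<open>auto simp: closed_upper_half_plane_def intro!: continuous_intros\<close>)
    then show "continuous_on closed_upper_half_plane (F n)"
      unfolding F_def using l0[of n] by (intro continuous_intros) auto
    show "norm (F n w) \<le> B / l n" if "Im w \<ge> 0" for w
      using bdd[of "of_real a + of_real (l n) * w"] l0[of n] that
      by (simp add: F_def norm_divide divide_right_mono)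
    show "norm (F n (of_real (r + t)) + F n (of_real (r - t)) - 2 * F n (of_real r)) \<le> C * t"
      if "t > 0" for r t
    proof -
      have "F n (of_real (r + t)) + F n (of_real (r - t)) - 2 * F n (of_real r) =
        (g (of_real ((a + l n * r) + l n * t)) + g (of_real ((a + l n * r) - l n * t))
           - 2 * g (of_real (a + l n * r))) / of_real (l n)"
        by (simp add: F_def algebra_simps diff_divide_distrib add_divide_distrib)
      then show ?thesis
        using zyg[of "l n * t" "a + l n * r"] l0[of n] that
        by (simp add: norm_divide divide_le_eq mult_ac del: of_real_add of_real_diff of_real_mult)
    qed
    have F0: "F n (of_real 0) = 0" using zeros(1) by (simp add: F_def)
    have F\<sigma>: "F n (of_real (\<sigma> n)) = 0"
      using zeros(2)[of n] l0[of n] by (simp add: F_def \<sigma>_def flip: of_real_mult)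
    show "F n (of_real s) = 0" "F n (of_real (\<sigma> n - s)) = 0" using that(1) F0 F\<sigma> by auto
    show "\<bar>(\<sigma> n - s) - s\<bar> = 1" using that(1) \<sigma>[of n] by auto
  qed (use that in auto)

  \<comment> \<open>The vertical difference quotient of the real part, which increases as \<open>y\<close> decreases to \<open>0\<close>;
      the bounds at \<open>\<i>\<close> for the rescalings keep it bounded along \<open>l n\<close>, hence everywhere.\<close>
  define p where "p = (\<lambda>y. Re (g (Complex a y)) / y)"
  have p_mono: "p y2 \<le> p y1" if "0 < y1" "y1 \<le> y2" for y1 y2
    unfolding p_def by (rule Re_vertical_ratio_nonincreasing[OF holo _ that]) (use pos less_imp_le in blast)
  have F_axis: "Re (F n (Complex 0 y)) = y * p (l n * y)" if "y > 0" for n y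
  proof -
    have "of_real a + of_real (l n) * Complex 0 y = Complex a (l n * y)" by (simp add: complex_eq_iff)
    then show ?thesis using that l0[of n] by (simp add: F_def p_def Re_divide_of_real)
  qed
  define K where "K = 5 * C * (sqrt (norm (complex_of_real 1 - \<i> * \<i>)) * norm (1 - \<i> * \<i>))"
  have p_le: "p y \<le> K" if "y > 0" for y
  proof -
    have "\<forall>\<^sub>F n in sequentially. l n < y" by (rule order_tendstoD(2)[OF l_lim that])
    then obtain n where n: "l n < y" by (auto simp: eventually_sequentially)
    have "p y \<le> p (l n * 1)" using n l0[of n] by (intro p_mono) auto
    also have "\<dots> = Re (F n (of_real 0 + \<i>))" using F_axis[of 1 n] by (simp add: Complex_eq)
    also have "\<dots> \<le> norm (F n (of_real 0 + \<i>))" by (rule complex_Re_le_cmod)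
    also have "\<dots> \<le> K" unfolding K_def by (rule F_bound) auto
    finally show ?thesis .
  qed
  define A where "A = (SUP y\<in>{0<..}. p y)"
  have bdd_p: "bdd_above (p ` {0<..})" using p_le by (intro bdd_aboveI[of _ K]) auto
  have p_A: "p y \<le> A" if "y > 0" for y unfolding A_def using that by (intro cSUP_upper bdd_p) auto
  have "p 1 > 0" using pos[of "Complex a 1"] by (simp add: p_def)
  with p_A[of 1] have A0: "A > 0" by simp
  have p_lim: "(\<lambda>n. p (l n * y)) \<longlonglongrightarrow> A" if y: "y > 0" for y
  proof (rule order_tendstoI)
    fix c assume "c < A"
    then obtain y0 where y0: "y0 > 0" "c < p y0"
      using less_cSUP_iff[OF _ bdd_p, of c] by (auto simp: A_def)
    have "\<forall>\<^sub>F n in sequentially. l n < y0 / y" by (rule order_tendstoD(2)[OF l_lim]) (use y y0 in auto)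
    then show "\<forall>\<^sub>F n in sequentially. c < p (l n * y)"
    proof eventually_elim
      case (elim n)
      then have "p y0 \<le> p (l n * y)" using y l0[of n] by (intro p_mono) (auto simp: pos_less_divide_eq)
      with y0 show ?case by simp
    qed
  next
    fix c assume "A < c"
    then show "\<forall>\<^sub>F n in sequentially. p (l n * y) < c"
      using p_A[of "l n * y" for n] y l0 by (intro always_eventually allI) (meson le_less_trans mult_pos_pos)
  qed

  \<comment> \<open>Normality of the rescalings, and identification of the limit.\<close>
  have op: "open upper_half_plane" by (simp add: upper_half_plane_def open_halfspace_Im_gt)
  have loc: "\<exists>b. \<forall>h\<in>range F. \<forall>z\<in>Q. norm (h z) \<le> b"
    if Q: "compact Q" "Q \<subseteq> upper_half_plane" for Q
  proof -
    have "continuous_on Q (\<lambda>z. 5 * C * (sqrt (norm (complex_of_real 1 - \<i> * z)) * norm (1 - \<i> * z)))"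
      by (intro continuous_intros)
    then have "bounded ((\<lambda>z. 5 * C * (sqrt (norm (complex_of_real 1 - \<i> * z)) * norm (1 - \<i> * z))) ` Q)"
      using Q(1) by (intro compact_imp_bounded compact_continuous_image)
    then obtain b where b: "\<And>z. z \<in> Q \<Longrightarrow>
        norm (5 * C * (sqrt (norm (complex_of_real 1 - \<i> * z)) * norm (1 - \<i> * z))) \<le> b"
      unfolding bounded_iff by blast
    have "norm (F n z) \<le> b" if "z \<in> Q" for n z
    proof -
      have "Im z \<ge> 0" using that Q(2) by (auto simp: upper_half_plane_def)
      from F_bound[of 0 n 1 z] this have
        "norm (F n z) \<le> 5 * C * (sqrt (norm (complex_of_real 1 - \<i> * z)) * norm (1 - \<i> * z))" by simp
      also have "\<dots> \<le> norm (5 * C * (sqrt (norm (complex_of_real 1 - \<i> * z)) * norm (1 - \<i> * z)))"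
        unfolding real_norm_def by (rule abs_ge_self)
      also have "\<dots> \<le> b" using that by (rule b)
      finally show ?thesis .
    qed
    then show ?thesis by blast
  qed
  obtain G r where G: "G holomorphic_on upper_half_plane" and r: "strict_mono (r :: nat \<Rightarrow> nat)"
    and lim: "\<And>z. z \<in> upper_half_plane \<Longrightarrow> (\<lambda>n. F (r n) z) \<longlonglongrightarrow> G z"
    by (rule Montel[OF op _ loc order_refl]) (use F_holo in blast)+
  have G_pos: "Re (G w) \<ge> 0" if "Im w > 0" for w
  proof -
    have "(\<lambda>n. Re (F (r n) w)) \<longlonglongrightarrow> Re (G w)"
      using that by (intro tendsto_Re lim) (simp add: upper_half_plane_def)
    moreover have "Re (F n w) \<ge> 0" for n
      using pos[of "of_real a + of_real (l n) * w"] l0[of n] that by (simp add: F_def Re_divide_of_real)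
    ultimately show ?thesis by (intro LIMSEQ_le_const) blast+
  qed
  have G_axis: "Re (G (Complex 0 y)) = A * y" if "y > 0" for y
  proof (rule LIMSEQ_unique)
    show "(\<lambda>n. Re (F (r n) (Complex 0 y))) \<longlonglongrightarrow> Re (G (Complex 0 y))"
      using that by (intro tendsto_Re lim) (simp add: upper_half_plane_def)
    have "(\<lambda>n. p (l (r n) * y) * y) \<longlonglongrightarrow> A * y"
      using LIMSEQ_subseq_LIMSEQ[OF p_lim[OF that] r] by (intro tendsto_intros) (simp add: o_def)
    then show "(\<lambda>n. Re (F (r n) (Complex 0 y))) \<longlonglongrightarrow> A * y"
      using F_axis[OF that] by (simp add: mult.commute)
  qed
  obtain c where c: "\<And>z. Im z > 0 \<Longrightarrow> G z = c - \<i> * of_real A * z"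
    using affine_if_Re_linear_on_axis[OF G G_pos G_axis] by blast

  \<comment> \<open>The sum of the moduli of continuity at the two zeros, at height \<open>e\<close>.  The sign of \<open>\<sigma> n\<close> may vary
      with \<open>n\<close>, so the limit is examined above both \<open>1\<close> and \<open>-1\<close>.\<close>
  define b where "b = (\<lambda>e. 10 * C * (sqrt (2 * e) * (1 + e)))"
  have "(b \<longlongrightarrow> 10 * C * (sqrt (2 * 0) * (1 + 0))) (at_right 0)"
    unfolding b_def by (intro tendsto_intros)
  then have "\<forall>\<^sub>F e in at_right 0. b e < A" using A0 by (intro order_tendstoD) auto
  moreover have "\<forall>\<^sub>F e in at_right 0. e > (0::real)" by (rule eventually_at_right_less)
  ultimately have "\<forall>\<^sub>F e in at_right 0. b e < A \<and> e > 0" by eventually_elim simp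
  then obtain e where e: "b e < A" "e > 0"
    using eventually_happens'[OF trivial_limit_at_right_real] by blast
  have diff_le: "norm (F n (of_real (\<sigma> n) + \<i> * of_real e) - F n (\<i> * of_real e)) \<le> b e" for n
  proof -
    have *: "norm (F n (of_real s + \<i> * of_real e)) \<le> 5 * C * (sqrt (2 * e) * (1 + e))"
      if "s = 0 \<or> s = \<sigma> n" for s
    proof -
      have "complex_of_real e - \<i> * (\<i> * of_real e) = of_real (2 * e)"
        "1 - \<i> * (\<i> * of_real e) = of_real (1 + e)" by (simp_all add: complex_eq_iff)
      then show ?thesis using F_bound[OF that e(2), of "\<i> * of_real e"] e(2)
        by (simp only: norm_of_real) simp
    qed
    from norm_triangle_le_diff[OF add_mono[OF *[of "\<sigma> n"] *[of 0]]] show ?thesis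
      by (simp add: b_def mult_ac)
  qed
  have diff_lim: "(\<lambda>n. norm (F (r n) (of_real s + \<i> * of_real e) - F (r n) (\<i> * of_real e))) \<longlonglongrightarrow> A"
    if "\<bar>s\<bar> = 1" for s
  proof -
    have "(\<lambda>n. norm (F (r n) (of_real s + \<i> * of_real e) - F (r n) (\<i> * of_real e)))
      \<longlonglongrightarrow> norm (G (of_real s + \<i> * of_real e) - G (\<i> * of_real e))"
      using e by (intro tendsto_intros lim) (auto simp: upper_half_plane_def)
    moreover have "G (of_real s + \<i> * of_real e) - G (\<i> * of_real e) = - \<i> * of_real (A * s)"
      using e by (simp add: c algebra_simps)
    then have "norm (G (of_real s + \<i> * of_real e) - G (\<i> * of_real e)) = A"
      using that A0 by (simp add: norm_mult)
    ultimately show ?thesis by simp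
  qed
  have "\<forall>\<^sub>F n in sequentially. b e < norm (F (r n) (of_real 1 + \<i> * of_real e) - F (r n) (\<i> * of_real e))
    \<and> b e < norm (F (r n) (of_real (-1) + \<i> * of_real e) - F (r n) (\<i> * of_real e))"
    using e(1) by (intro eventually_conj order_tendstoD(1)[OF diff_lim]) auto
  then obtain n where
    "b e < norm (F (r n) (of_real 1 + \<i> * of_real e) - F (r n) (\<i> * of_real e))"
    "b e < norm (F (r n) (of_real (-1) + \<i> * of_real e) - F (r n) (\<i> * of_real e))"
    using eventually_happens'[OF trivial_limit_sequentially] by blast
  with diff_le[of "r n"] \<sigma>[of "r n"] show False by (metis not_le)
qed

text \<open>
  The zeros of \<open>1 - f\<close> include \<open>E\<close>, and an infinite compact set accumulates at one of its own points.
\<close>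

theorem theorem4p4:
  fixes E :: "real set"
  assumes "compact E" and "peak_set_A_star E"
  shows "finite E"
proof (rule ccontr)
  assume "infinite E"
  with assms(1) obtain a where a: "a \<in> E" "a islimpt E"
    by (metis compact_eq_Bolzano_Weierstrass order_refl)
  from a(2) obtain x where x: "\<And>n. x n \<in> E - {a}" "x \<longlonglongrightarrow> a"
    unfolding islimpt_sequential by blast
  from assms(2) obtain f where f: "f \<in> A_star" and one: "\<And>x. x \<in> E \<Longrightarrow> f (of_real x) = 1"
    and less: "\<And>z. z \<in> closed_upper_half_plane - of_real ` E \<Longrightarrow> norm (f z) < 1"
    unfolding peak_set_A_star_def by blast
  from f have cont: "continuous_on closed_upper_half_plane f" and holo: "f holomorphic_on upper_half_plane"
    by (simp_all add: A_star_def)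
  from f obtain B where B: "\<And>z. Im z \<ge> 0 \<Longrightarrow> norm (f z) \<le> B"
    unfolding A_star_def bounded_iff closed_upper_half_plane_def by blast
  from f obtain C where C: "\<And>x t. t > 0 \<Longrightarrow> norm (f (of_real (x + t)) + f (of_real (x - t)) - 2 * f (of_real x)) \<le> C * t"
    unfolding A_star_def zygmund_def by blast
  show False
  proof (rule no_accumulating_zeros[of "\<lambda>z. 1 - f z" "1 + B" C a x])
    show "(\<lambda>z. 1 - f z) holomorphic_on upper_half_plane" by (intro holomorphic_intros holo)
    show "continuous_on closed_upper_half_plane (\<lambda>z. 1 - f z)" by (intro continuous_intros cont)
    show "norm (1 - f z) \<le> 1 + B" if "Im z \<ge> 0" for z
      using norm_triangle_ineq4[of 1 "f z"] B[OF that] by simp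
    show "norm (1 - f (of_real (x + t)) + (1 - f (of_real (x - t))) - 2 * (1 - f (of_real x))) \<le> C * t"
      if "t > 0" for x t
    proof -
      have "1 - f (of_real (x + t)) + (1 - f (of_real (x - t))) - 2 * (1 - f (of_real x)) =
        - (f (of_real (x + t)) + f (of_real (x - t)) - 2 * f (of_real x))" by (simp add: algebra_simps)
      then show ?thesis using C[OF that, of x] by (simp only: norm_minus_cancel)
    qed
    show "Re (1 - f w) > 0" if "Im w > 0" for w
    proof -
      have "w \<in> closed_upper_half_plane - of_real ` E" using that by (auto simp: closed_upper_half_plane_def)
      then show ?thesis using less complex_Re_le_cmod[of "f w"] by force
    qed
  qed (use one a x in auto)
qed

end
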